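(* Let $n \in \mathbb{N}$ ($n\ge1$), $a,b,c,d \in \mathbb{C}$, and let $\lambda_1,\dots,\lambda_{n+2}$, $\mathbf{H}_n$, and (according to the parity of $n$) $\mathbf{u},\mathbf{v},\mathbf{R}_n,\mathbf{P}_n$ be as defined in the context. Suppose that $\lambda_{k} \neq 0$ for every $k = 1,2,\ldots,n+2$ and that $\mathbf{H}_{n}$ is nonsingular. (a) If $n$ is even, put $\mathbf{D}=\mathrm{diag}(\lambda_{3}^{-1},\lambda_{5}^{-1},\ldots,\lambda_{n+1}^{-1})$ and $\mathbf{E}=\mathrm{diag}(\lambda_{2}^{-1},\lambda_{4}^{-1},\ldots,\lambda_{n}^{-1})$. Then $$\mathbf{H}_{n}^{-1} = \mathbf{R}_{n} \mathbf{P}_{n}^{\top} \begin{bmatrix}\mathbf{U}_{n/2} & \mathbf{O} \\ \mathbf{O} & \mathbf{V}_{n/2}\end{bmatrix} \mathbf{P}_{n} \mathbf{R}_{n},$$ where $$\mathbf{U}_{n/2} = (\mathbf{I}_{n/2} + \mathbf{u} \mathbf{u}^{\top}) \left[\mathbf{D} - \frac{\lambda_{1}}{1 + \lambda_{1} \mathbf{u}^{\top} \mathbf{D}\mathbf{u}}\, \mathbf{D} \mathbf{u} \mathbf{u}^{\top} \mathbf{D} \right] (\mathbf{I}_{n/2} + \mathbf{u} \mathbf{u}^{\top}),$$ $$\mathbf{V}_{n/2} = (\mathbf{I}_{n/2} + \mathbf{v} \mathbf{v}^{\top}) \left[\mathbf{E} - \frac{\lambda_{n+2}}{1 + \lambda_{n+2}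 \mathbf{v}^{\top} \mathbf{E}\mathbf{v}}\, \mathbf{E} \mathbf{v} \mathbf{v}^{\top} \mathbf{E} \right] (\mathbf{I}_{n/2} + \mathbf{v} \mathbf{v}^{\top}).$$ (b) If $n$ is odd, put $\mathbf{D}=\mathrm{diag}(\lambda_{3}^{-1},\lambda_{5}^{-1},\ldots,\lambda_{n}^{-1},\lambda_{n+2}^{-1})$ and $\mathbf{E}=\mathrm{diag}(\lambda_{2}^{-1},\lambda_{4}^{-1},\ldots,\lambda_{n-1}^{-1})$. Then $$\mathbf{H}_{n}^{-1} = \mathbf{R}_{n} \mathbf{P}_{n} \begin{bmatrix}\mathbf{U}_{(n+1)/2} & \mathbf{O} \\ \mathbf{O} & \mathbf{V}_{(n-1)/2}\end{bmatrix} \mathbf{P}_{n}^{\top} \mathbf{R}_{n}^{\top},$$ where $$\mathbf{U}_{(n+1)/2} = (\mathbf{I}_{(n+1)/2} + \mathbf{u} \mathbf{u}^{\top}) \left[\mathbf{D} - \frac{\lambda_{1}}{1 + \lambda_{1} \mathbf{u}^{\top} \mathbf{D}\mathbf{u}}\, \mathbf{D} \mathbf{u} \mathbf{u}^{\top} \mathbf{D} \right] (\mathbf{I}_{(n+1)/2} + \mathbf{u} \mathbf{u}^{\top}),$$ $$\mathbf{V}_{(n-1)/2} = (\mathbf{I}_{(n-1)/2} + \mathbf{v} \mathbf{v}^{\top}) \left[\mathbf{E} - \frac{\lambda_{n+1}}{1 + \lambda_{n+1} \mathbf{v}^{\top} \mathbf{E}\mathbf{v}}\, \mathbf{E} \mathbf{v}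 \mathbf{v}^{\top} \mathbf{E} \right] (\mathbf{I}_{(n-1)/2} + \mathbf{v} \mathbf{v}^{\top}).$$
   Context: For $n\in\mathbb{N}$ and scalars $a,b,c,d$, $\mathbf{H}_n$ is the $n\times n$ anti-heptadiagonal persymmetric Hankel matrix with entries $[\mathbf{H}_n]_{k,\ell}=d$ if $k+\ell=n+1$; $=c$ if $|k+\ell-n-1|=1$; $=b$ if $|k+\ell-n-1|=2$; $=a$ if $|k+\ell-n-1|=3$; and $=0$ otherwise. For $k=1,2,\ldots,n+2$, $$\lambda_{k} = -2a \cos \left(\tfrac{n k \pi}{n+3} \right) - 2b \cos \left(\tfrac{(n + 1) k \pi}{n+3} \right) - 2c \cos \left(\tfrac{(n + 2) k \pi}{n+3} \right) - d \cos (k \pi).$$ Case $n$ even. $\mathbf{u},\mathbf{v}\in\mathbb{R}^{n/2}$ with $u_j=\frac{\sin((2j+1)\pi/(n+3))}{\sin(\pi/(n+3))}$, $v_j=\frac{\sin(2j\pi/(n+3))}{\sin(\pi/(n+3))}$, $1\le j\le n/2$. $\mathbf{R}_n$ is the $n\times n$ matrix $[\mathbf{R}_n]_{k,\ell}=\sqrt{\frac{2}{n+3}}\sin\left(\frac{(k+1)(\ell+1)\pi}{n+3}\right)$. $\mathbf{P}_n$ is the $n\times n$ permutation matrix with $[\mathbf{P}_n]_{k,\ell}=1$ if $\ell=2k$ or $\ell=2k-n-1$, and $0$ otherwise. Case $n$ odd. $\mathbf{u}\in\mathbb{R}^{(n+1)/2}$ with $u_j=\frac{\sin((2j+1)\pi/(n+3))}{\sin(\pi/(n+3))}$,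 $1\le j\le \frac{n+1}2$ (so the last component is $1$), and $\mathbf{v}\in\mathbb{R}^{(n-1)/2}$ with $v_j=\frac{\sin(2j\pi/(n+3))}{\sin((n+1)\pi/(n+3))}$, $1\le j\le\frac{n-1}2$. $\mathbf{R}_n$ is the $n\times n$ matrix with $[\mathbf{R}_n]_{k,\ell}=\sqrt{\frac{2}{n+3}}\sin\left(\frac{(k+1)(\ell+1)\pi}{n+3}\right)$ if $\ell<n$ and $[\mathbf{R}_n]_{k,n}=\sqrt{\frac{2}{n+3}}\sin\left(\frac{(k+1)(n+2)\pi}{n+3}\right)$. $\mathbf{P}_n$ is the $n\times n$ permutation matrix with $[\mathbf{P}_n]_{k,\ell}=1$ if $k=2\ell$, or $k=2\ell-n-2$, or ($k=n$ and $\ell=\frac{n+1}2$), and $0$ otherwise. $\mathbf{O}$ denotes zero blocks; for $n=1$ blocks of size $(n-1)/2=0$ are absent. *)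

theory Defs
  imports Complex_Main "Jordan_Normal_Form.Gauss_Jordan_Elimination"
begin

(* Vectors and matrices are 0-based in the library; these two constructors let every
   entry formula below be written with the usual indices 1, ..., n. *)
definition vec1 :: "nat \<Rightarrow> (nat \<Rightarrow> 'a) \<Rightarrow> 'a vec" where
  "vec1 m f = vec m (\<lambda>j. f (j + 1))"

definition mat1 :: "nat \<Rightarrow> nat \<Rightarrow> (nat \<Rightarrow> nat \<Rightarrow> 'a) \<Rightarrow> 'a mat" where
  "mat1 m n f = mat m n (\<lambda>(i, j). f (i + 1) (j + 1))"

definition diag1 :: "nat \<Rightarrow> (nat \<Rightarrow> 'a :: zero) \<Rightarrow> 'a mat" where
  "diag1 m f = mat_diag m (\<lambda>j. f (j + 1))"

definition outer_prod :: "'a :: times vec \<Rightarrow> 'a vec \<Rightarrow> 'a mat" where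
  "outer_prod x y = mat (dim_vec x) (dim_vec y) (\<lambda>(i, j). x $ i * y $ j)"

definition hankel :: "nat \<Rightarrow> complex \<Rightarrow> complex \<Rightarrow> complex \<Rightarrow> complex \<Rightarrow> complex mat" where
  "hankel n a b c d = mat1 n n (\<lambda>k l.
     let r = \<bar>int k + int l - int n - 1\<bar> in
       if r = 0 then d else if r = 1 then c else if r = 2 then b else if r = 3 then a else 0)"

definition lam :: "nat \<Rightarrow> complex \<Rightarrow> complex \<Rightarrow> complex \<Rightarrow> complex \<Rightarrow> nat \<Rightarrow> complex" where
  "lam n a b c d k =
     - 2 * a * complex_of_real (cos (real n * real k * pi / (real n + 3)))
     - 2 * b * complex_of_real (cos ((real n + 1) * real k * pi / (real n + 3)))
     - 2 * c * complex_of_real (cos ((real n + 2) * real k * pi / (real n + 3)))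
     - d * complex_of_real (cos (real k * pi))"

(* The real vectors u, v and the real matrices R, P are embedded in the complex numbers. *)

definition u_even :: "nat \<Rightarrow> complex vec" where
  "u_even n = vec1 (n div 2) (\<lambda>j. complex_of_real
     (sin ((2 * real j + 1) * pi / (real n + 3)) / sin (pi / (real n + 3))))"

definition v_even :: "nat \<Rightarrow> complex vec" where
  "v_even n = vec1 (n div 2) (\<lambda>j. complex_of_real
     (sin (2 * real j * pi / (real n + 3)) / sin (pi / (real n + 3))))"

definition R_even :: "nat \<Rightarrow> complex mat" where
  "R_even n = mat1 n n (\<lambda>k l. complex_of_real
     (sqrt (2 / (real n + 3)) * sin ((real k + 1) * (real l + 1) * pi / (real n + 3))))"

(* The second condition is l = 2 k - n - 1, written without truncated subtraction. *)
definition P_even :: "nat \<Rightarrow> complex mat" where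
  "P_even n = mat1 n n (\<lambda>k l. if l = 2 * k \<or> l + n + 1 = 2 * k then 1 else 0)"

definition u_odd :: "nat \<Rightarrow> complex vec" where
  "u_odd n = vec1 ((n + 1) div 2) (\<lambda>j. complex_of_real
     (sin ((2 * real j + 1) * pi / (real n + 3)) / sin (pi / (real n + 3))))"

definition v_odd :: "nat \<Rightarrow> complex vec" where
  "v_odd n = vec1 ((n - 1) div 2) (\<lambda>j. complex_of_real
     (sin (2 * real j * pi / (real n + 3)) / sin ((real n + 1) * pi / (real n + 3))))"

definition R_odd :: "nat \<Rightarrow> complex mat" where
  "R_odd n = mat1 n n (\<lambda>k l. complex_of_real
     (if l < n
      then sqrt (2 / (real n + 3)) * sin ((real k + 1) * (real l + 1) * pi / (real n + 3))
      else sqrt (2 / (real n + 3)) * sin ((real k + 1) * (real n + 2) * pi / (real n + 3))))"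

(* The second condition is k = 2 l - n - 2, written without truncated subtraction. *)
definition P_odd :: "nat \<Rightarrow> complex mat" where
  "P_odd n = mat1 n n (\<lambda>k l.
     if k = 2 * l \<or> k + n + 2 = 2 * l \<or> (k = n \<and> l = (n + 1) div 2) then 1 else 0)"

(* (I + w w^T) [M - mu / (1 + mu w^T M w) M w w^T M] (I + w w^T);
   the scalar product is the bilinear one, without conjugation. *)
definition inv_block :: "complex \<Rightarrow> complex vec \<Rightarrow> complex mat \<Rightarrow> complex mat" where
  "inv_block \<mu> w M =
     (let J = 1\<^sub>m (dim_vec w) + outer_prod w w in
       J * (M - (\<mu> / (1 + \<mu> * (w \<bullet> (M *\<^sub>v w)))) \<cdot>\<^sub>m (M * outer_prod w w * M)) * J)"

definition block_diag :: "'a :: zero mat \<Rightarrow> 'a mat \<Rightarrow> 'a mat" where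
  "block_diag A B =
     four_block_mat A (0\<^sub>m (dim_row A) (dim_col B)) (0\<^sub>m (dim_row B) (dim_col A)) B"

end

(* The (n+2) x (n+2) sine matrix S diagonalizes a matrix whose middle n x n block is H_n, so that
   H_n = sum_m lam_m s_m s_m^T, where s_m is the m-th column of S without its first and last entry.
   Orthogonality of the middle rows of S to the two deleted ones expresses s_1 through the other odd
   columns and s_e (e the largest even index at most n + 2) through the other even ones, with
   coefficients -u and -v. Hence H_n = Q diag(A, B) Q^T with A and B diagonal plus a rank-one term,
   and the same identity with all lam_m = 1 gives Q^(-1) = diag(I + u u^T, I + v v^T) Q^T.
   The blocks A and B are inverted by the Sherman-Morrison formula, and Q is R_n with its columns
   permuted by P_n. *)

theory Submission
  imports Defs "Jordan_Normal_Form.Determinant"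
begin

section \<open>Trigonometric sums\<close>

text \<open>Each term \<open>2 * sin (x / 2) * cos (m * x)\<close> is the difference of
  \<open>sin (m * x + x / 2)\<close> and \<open>sin (m * x - x / 2)\<close>. The factor stays on the
  left because it may vanish.\<close>

lemma sum_cos_telescope:
  fixes x :: real
  assumes "1 \<le> N"
  shows "2 * sin (x / 2) * (\<Sum>m = 1..<N. cos (real m * x)) = sin (real N * x - x / 2) - sin (x / 2)"
  using assms
proof (induction N rule: dec_induct)
  case base
  show ?case by (simp add: field_simps)
next
  case (step N)
  have "2 * sin (x / 2) * cos (real N * x) = sin (real N * x + x / 2) - sin (real N * x - x / 2)"
    by (simp add: sin_add sin_diff)
  moreover have "real (Suc N) * x - x / 2 = real N * x + x / 2"
    by (simp add: algebra_simps)
  ultimately show ?case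
    using step by (simp add: distrib_left add.commute del: of_nat_Suc)
qed

text \<open>If \<open>2 * N\<close> divides \<open>r\<close>, all \<open>N - 1\<close> cosines are
  1. Otherwise the factor \<open>sin (x / 2)\<close> with \<open>x = r * pi / N\<close> is nonzero
  and cancels from the telescoped sum, leaving -1 or 0 according to the parity of
  \<open>r\<close>.\<close>

lemma sum_cos_multiples:
  fixes r :: int
  assumes "1 \<le> N"
  shows "(\<Sum>m = 1..<N. cos (of_int r * real m * pi / real N))
    = real N * of_bool (2 * int N dvd r) - of_bool (even r)"
proof (cases "2 * int N dvd r")
  case True
  then obtain s where s: "r = 2 * int N * s" by (elim dvdE)
  have "cos (of_int r * real m * pi / real N) = 1" for m
  proof -
    have "of_int r * real m * pi / real N = 2 * pi * of_int (s * int m)"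
      using assms by (simp add: s)
    then show ?thesis by (metis cos_int_2pin)
  qed
  then have "(\<Sum>m = 1..<N. cos (of_int r * real m * pi / real N)) = real (N - 1)" by simp
  then show ?thesis using True assms by (simp add: s of_nat_diff)
next
  case False
  define x where "x = of_int r * pi / real N"
  have nz: "sin (x / 2) \<noteq> 0"
  proof
    assume "sin (x / 2) = 0"
    then obtain i :: int where "x / 2 = of_int i * pi"
      using sin_zero_iff_int2 by blast
    then have "of_int r = (of_int (2 * int N * i) :: real)"
      using assms by (simp add: x_def field_simps)
    then have "r = 2 * int N * i" by (simp only: of_int_eq_iff)
    then show False using False by simp
  qed
  have eq: "(\<Sum>m = 1..<N. cos (of_int r * real m * pi / real N)) = (\<Sum>m = 1..<N. cos (real m * x))"
    by (simp add: x_def mult_ac)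
  have "real N * x = pi * of_int r" using assms by (simp add: x_def)
  then have "sin (real N * x - x / 2) = - cos (pi * of_int r) * sin (x / 2)"
    by (simp only: sin_diff sin_npi_int)
  then have "2 * sin (x / 2) * (\<Sum>m = 1..<N. cos (real m * x)) = - 2 * of_bool (even r) * sin (x / 2)"
    using sum_cos_telescope[OF assms, of x] by (cases "even r") simp_all
  then have "sin (x / 2) * ((\<Sum>m = 1..<N. cos (real m * x)) + of_bool (even r)) = 0"
    unfolding distrib_left by (simp only: mult.commute[of "of_bool _"] mult.assoc)
  then have "(\<Sum>m = 1..<N. cos (real m * x)) = - of_bool (even r)"
    using nz unfolding mult_eq_0_iff eq_neg_iff_add_eq_0 by blast
  then show ?thesis using False eq by simp
qed

text \<open>The product splits into four cosines whose frequencies have the same parity, so the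
  parity corrections of the four sums cancel.\<close>

lemma sum_sin_sin_cos:
  fixes i j r :: nat
  assumes "1 \<le> N"
  shows "(\<Sum>m = 1..<N. sin (real i * real m * pi / real N) * sin (real j * real m * pi / real N)
            * cos (real r * real m * pi / real N))
    = real N / 4 * (of_bool (2 * int N dvd int i - int j - int r) + of_bool (2 * int N dvd int i - int j + int r)
        - of_bool (2 * int N dvd int i + int j - int r) - of_bool (2 * int N dvd int i + int j + int r))"
proof -
  let ?c = "\<lambda>s m. cos (of_int s * real m * pi / real N)"
  have "sin (real i * real m * pi / real N) * sin (real j * real m * pi / real N)
            * cos (real r * real m * pi / real N)
     = (?c (int i - int j - int r) m + ?c (int i - int j + int r) m
        - ?c (int i + int j - int r) m - ?c (int i + int j + int r) m) / 4" for m
  proof -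
    define x y z where "x = real i * real m * pi / real N" and "y = real j * real m * pi / real N"
      and "z = real r * real m * pi / real N"
    have "of_int (int i - int j - int r) * real m * pi / real N = x - y - z"
      "of_int (int i - int j + int r) * real m * pi / real N = x - y + z"
      "of_int (int i + int j - int r) * real m * pi / real N = x + y - z"
      "of_int (int i + int j + int r) * real m * pi / real N = x + y + z"
      by (simp_all add: x_def y_def z_def algebra_simps diff_divide_distrib add_divide_distrib)
    moreover have "4 * (sin x * sin y * cos z) = cos (x - y - z) + cos (x - y + z) - cos (x + y - z) - cos (x + y + z)"
      by (simp add: cos_add cos_diff algebra_simps sin_add sin_diff)
    ultimately show ?thesis unfolding x_def[symmetric] y_def[symmetric] z_def[symmetric] by simp
  qed
  then have "(\<Sum>m = 1..<N. sin (real i * real m * pi / real N) * sin (real j * real m * pi / real N)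
            * cos (real r * real m * pi / real N))
     = ((\<Sum>m = 1..<N. ?c (int i - int j - int r) m) + (\<Sum>m = 1..<N. ?c (int i - int j + int r) m)
        - (\<Sum>m = 1..<N. ?c (int i + int j - int r) m) - (\<Sum>m = 1..<N. ?c (int i + int j + int r) m)) / 4"
    by (simp only: sum.distrib sum_subtractf sum_divide_distrib[symmetric])
  also have "\<dots> = real N / 4 * (of_bool (2 * int N dvd int i - int j - int r) + of_bool (2 * int N dvd int i - int j + int r)
        - of_bool (2 * int N dvd int i + int j - int r) - of_bool (2 * int N dvd int i + int j + int r))"
  proof -
    have "even (int i - int j - int r) = even (int i + int j + int r)"
      "even (int i - int j + int r) = even (int i + int j + int r)"
      "even (int i + int j - int r) = even (int i + int j + int r)"
      by simp_all
    moreover have "((N * w - e) + (N * x - e) - (N * y - e) - (N * z - e)) / 4 = N / 4 * (w + x - y - z)"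
      for N w x y z e :: real by (simp add: field_simps)
    ultimately show ?thesis unfolding sum_cos_multiples[OF assms] by (simp only:)
  qed
  finally show ?thesis .
qed

lemma dvd_small_iff: "\<bar>x\<bar> < k \<Longrightarrow> k dvd x \<longleftrightarrow> x = 0" for k x :: int
  using dvd_imp_le_int[of x k] by (cases "x = 0") (simp, linarith)

lemma sum_sin_sin:
  assumes "1 \<le> i" "i < N" "1 \<le> j" "j < N"
  shows "(\<Sum>m = 1..<N. sin (real i * real m * pi / real N) * sin (real j * real m * pi / real N))
    = real N / 2 * of_bool (i = j)"
proof -
  have "2 * int N dvd int i - int j \<longleftrightarrow> i = j" "\<not> 2 * int N dvd int i + int j"
    using assms by (subst dvd_small_iff; auto)+
  then show ?thesis
    using sum_sin_sin_cos[of N i j 0] assms by simp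
qed

text \<open>Since \<open>\<bar>i - j\<bar> \<le> N - 4 < r\<close>, the two difference frequencies
  are nonzero and smaller than \<open>2 * N\<close> in modulus. The sum frequencies survive on two
  antidiagonals, at distance \<open>N - r\<close> on either side of
  \<open>i + j = N\<close>.\<close>

lemma sum_sin_sin_cos_middle:
  assumes "2 \<le> i" "i + 2 \<le> N" "2 \<le> j" "j + 2 \<le> N" "N \<le> r + 3" "r \<le> N"
  shows "(\<Sum>m = 1..<N. sin (real i * real m * pi / real N) * sin (real j * real m * pi / real N)
            * cos (real r * real m * pi / real N))
    = - real N / 4 * (of_bool (i + j = r) + of_bool (i + j + r = 2 * N))"
proof -
  have "\<not> 2 * int N dvd int i - int j - int r"
    using assms dvd_small_iff[of "int i - int j - int r" "2 * int N"] by linarith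
  moreover have "\<not> 2 * int N dvd int i - int j + int r"
    using assms dvd_small_iff[of "int i - int j + int r" "2 * int N"] by linarith
  moreover have "2 * int N dvd int i + int j - int r \<longleftrightarrow> i + j = r"
    using assms dvd_small_iff[of "int i + int j - int r" "2 * int N"] by linarith
  \<comment> \<open>This frequency lies strictly between 0 and \<open>4 * N\<close>, so the only
    candidate multiple is \<open>2 * N\<close>; the shift brings it into the range of
    \<open>dvd_small_iff\<close>.\<close>
  moreover have "2 * int N dvd int i + int j + int r - 2 * int N \<longleftrightarrow> i + j + r = 2 * N"
    using assms dvd_small_iff[of "int i + int j + int r - 2 * int N" "2 * int N"] by linarith
  then have "2 * int N dvd int i + int j + int r \<longleftrightarrow> i + j + r = 2 * N"
    by (metis dvd_add_right_iff dvd_refl diff_add_cancel add.commute)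
  moreover have "1 \<le> N" using assms by linarith
  note sum_sin_sin_cos[OF this, of i j r]
  ultimately show ?thesis
    by (simp only: of_bool_eq) argo
qed

lemma sum_split_parity:
  fixes f :: "nat \<Rightarrow> 'a :: comm_monoid_add"
  shows "(\<Sum>m = 1..<n + 1. f m) = (\<Sum>i < (n + 1) div 2. f (2 * i + 1)) + (\<Sum>j < n div 2. f (2 * j + 2))"
proof (induction n)
  case (Suc n)
  show ?case
  proof (cases "even n")
    case True
    then obtain k where "n = 2 * k" by (elim evenE)
    then show ?thesis using Suc by (simp add: add_ac)
  next
    case False
    then obtain k where "n = 2 * k + 1" by (elim oddE)
    then show ?thesis using Suc by (simp add: add_ac)
  qed
qed simp

section \<open>Diagonal matrices plus a rank-one term\<close>

text \<open>Covers both the blocks carrying the \<open>lam\<close> values and the factors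
  \<open>I + w w^T\<close>, where \<open>f\<close> and \<open>\<mu>\<close> are 1.\<close>

definition diag_rank1 :: "(nat \<Rightarrow> 'a) \<Rightarrow> 'a \<Rightarrow> 'a vec \<Rightarrow> 'a :: comm_ring_1 mat" where
  "diag_rank1 f \<mu> w = mat_diag (dim_vec w) f + \<mu> \<cdot>\<^sub>m outer_prod w w"

lemma outer_prod_carrier [simp]: "outer_prod v w \<in> carrier_mat (dim_vec v) (dim_vec w)"
  by (simp add: outer_prod_def)

lemma outer_prod_dim [simp]: "dim_row (outer_prod v w) = dim_vec v" "dim_col (outer_prod v w) = dim_vec w"
  by (simp_all add: outer_prod_def)

lemma diag_rank1_carrier [simp]: "diag_rank1 f \<mu> w \<in> carrier_mat (dim_vec w) (dim_vec w)"
  by (simp add: diag_rank1_def)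

lemma diag_rank1_dim [simp]: "dim_row (diag_rank1 f \<mu> w) = dim_vec w" "dim_col (diag_rank1 f \<mu> w) = dim_vec w"
  by (simp_all add: diag_rank1_def)

lemma diag_rank1_index [simp]:
  "i < dim_vec w \<Longrightarrow> j < dim_vec w \<Longrightarrow>
    diag_rank1 f \<mu> w $$ (i, j) = (if i = j then f i else 0) + \<mu> * (w $ i * w $ j)"
  by (auto simp: diag_rank1_def outer_prod_def mat_diag_def)

lemma mat_mult_entry:
  "A \<in> carrier_mat n m \<Longrightarrow> B \<in> carrier_mat m k \<Longrightarrow> i < n \<Longrightarrow> j < k \<Longrightarrow>
    (A * B) $$ (i, j) = (\<Sum>s<m. A $$ (i, s) * B $$ (s, j))"
  by (simp add: scalar_prod_def lessThan_atLeast0)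

lemma mat_diag_mult_vec:
  "w \<in> carrier_vec n \<Longrightarrow> mat_diag n f *\<^sub>v w = vec n (\<lambda>i. f i * w $ i)"
  for w :: "'a :: comm_ring_1 vec"
  by (intro eq_vecI) (auto simp: mat_diag_def scalar_prod_def if_distrib[of "\<lambda>x. x * _"] cong: if_cong)

lemma outer_prod_mult_vec:
  "dim_vec z = dim_vec w \<Longrightarrow> outer_prod v w *\<^sub>v z = (w \<bullet> z) \<cdot>\<^sub>v v"
  for w :: "'a :: comm_ring_1 vec"
  by (intro eq_vecI) (auto simp: outer_prod_def scalar_prod_def sum_distrib_left mult_ac)

text \<open>If the scalar were 0, then \<open>z = D w\<close>, with \<open>D\<close> the inverse of
  the diagonal part, would satisfy
  \<open>(F + \<mu> w w^T) z = (1 + \<mu> (w \<bullet> z)) w = 0\<close>. Nonsingularity gives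
  \<open>z = 0\<close>, and then the scalar is 1.\<close>

lemma sherman_morrison_scalar_nonzero:
  fixes w :: "'a :: field vec"
  assumes f: "\<And>i. i < dim_vec w \<Longrightarrow> f i \<noteq> 0" and det: "det (diag_rank1 f \<mu> w) \<noteq> 0"
  shows "1 + \<mu> * (w \<bullet> (mat_diag (dim_vec w) (\<lambda>i. inverse (f i)) *\<^sub>v w)) \<noteq> 0"
proof
  define p where "p = dim_vec w"
  define z where "z = mat_diag p (\<lambda>i. inverse (f i)) *\<^sub>v w"
  assume "1 + \<mu> * (w \<bullet> (mat_diag (dim_vec w) (\<lambda>i. inverse (f i)) *\<^sub>v w)) = 0"
  then have eq: "1 + \<mu> * (w \<bullet> z) = 0" by (simp add: z_def p_def)
  have w: "w \<in> carrier_vec p" and z: "z \<in> carrier_vec p"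
    by (auto simp: p_def z_def mat_diag_mult_vec)
  have zi: "z $ i = inverse (f i) * w $ i" if "i < p" for i
    using that w by (simp add: z_def mat_diag_mult_vec)
  have "diag_rank1 f \<mu> w *\<^sub>v z = mat_diag p f *\<^sub>v z + (\<mu> \<cdot>\<^sub>m outer_prod w w) *\<^sub>v z"
    unfolding diag_rank1_def p_def[symmetric] using z by (intro add_mult_distrib_mat_vec) (auto simp: p_def)
  also have "\<dots> = 0\<^sub>v p"
  proof (intro eq_vecI)
    fix i assume i: "i < dim_vec (0\<^sub>v p)"
    have "(\<mu> \<cdot>\<^sub>m outer_prod w w) *\<^sub>v z = \<mu> \<cdot>\<^sub>v (outer_prod w w *\<^sub>v z)"
      using z w by (intro eq_vecI) auto
    then have "(\<mu> \<cdot>\<^sub>m outer_prod w w) *\<^sub>v z = \<mu> \<cdot>\<^sub>v ((w \<bullet> z) \<cdot>\<^sub>v w)"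
      using z w by (simp add: outer_prod_mult_vec)
    moreover have "f i * (inverse (f i) * w $ i) + \<mu> * ((w \<bullet> z) * w $ i) = (1 + \<mu> * (w \<bullet> z)) * w $ i"
      using i f[of i] by (simp add: p_def algebra_simps)
    ultimately show "(mat_diag p f *\<^sub>v z + (\<mu> \<cdot>\<^sub>m outer_prod w w) *\<^sub>v z) $ i = 0\<^sub>v p $ i"
      using i z w eq by (simp add: mat_diag_mult_vec zi)
  qed (use w z in auto)
  finally have "z = 0\<^sub>v p"
    using det z det_0_iff_vec_prod_zero_field[of "diag_rank1 f \<mu> w" p] by (auto simp: p_def)
  then show False using eq w by simp
qed

text \<open>The product differs from the identity by
  \<open>(\<mu> - \<kappa> - \<mu> * \<kappa> * \<sigma>)\<close> times \<open>w w^T D\<close>, and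
  \<open>\<kappa>\<close> is the root that makes this scalar vanish.\<close>

lemma sherman_morrison:
  fixes w :: "'a :: field vec"
  assumes f: "\<And>i. i < dim_vec w \<Longrightarrow> f i \<noteq> 0" and det: "det (diag_rank1 f \<mu> w) \<noteq> 0"
    and D: "D = mat_diag (dim_vec w) (\<lambda>i. inverse (f i))"
  shows "diag_rank1 f \<mu> w * (D - (\<mu> / (1 + \<mu> * (w \<bullet> (D *\<^sub>v w)))) \<cdot>\<^sub>m (D * outer_prod w w * D))
    = 1\<^sub>m (dim_vec w)"
proof -
  define p where "p = dim_vec w"
  define g where "g i = inverse (f i)" for i
  define \<sigma> where "\<sigma> = w \<bullet> (D *\<^sub>v w)"
  define \<kappa> where "\<kappa> = \<mu> / (1 + \<mu> * \<sigma>)"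
  have w: "w \<in> carrier_vec p" by (simp add: p_def)
  have D': "D = mat_diag p g" by (simp add: D p_def g_def[abs_def])
  have fg: "f i * g i = 1" if "i < p" for i using f that by (simp add: p_def g_def)
  have "1 + \<mu> * \<sigma> \<noteq> 0"
    using sherman_morrison_scalar_nonzero[of w f \<mu>] f det by (simp add: \<sigma>_def D)
  \<comment> \<open>The nonzero denominator matters: division by 0 would give
    \<open>\<kappa> = 0\<close>, and the equation would fail.\<close>
  then have \<kappa>: "\<mu> - \<kappa> - \<mu> * \<kappa> * \<sigma> = 0" by (simp add: \<kappa>_def divide_simps algebra_simps)
  have \<sigma>: "\<sigma> = (\<Sum>k<p. w $ k * (g k * w $ k))"
    using w by (simp add: \<sigma>_def D' mat_diag_mult_vec scalar_prod_def lessThan_atLeast0)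
  have inner: "(D - \<kappa> \<cdot>\<^sub>m (D * outer_prod w w * D)) $$ (k, j) = (if k = j then g k else 0) - \<kappa> * (g k * w $ k * w $ j * g j)"
    if "k < p" "j < p" for k j
    using that w by (simp add: D' mat_diag_mult_left[of _ p p] mat_diag_mult_right[of _ p p] outer_prod_def)
      (auto simp: mat_diag_def mult_ac)
  have "diag_rank1 f \<mu> w * (D - \<kappa> \<cdot>\<^sub>m (D * outer_prod w w * D)) = 1\<^sub>m p"
  proof (intro eq_matI)
    fix i j assume "i < dim_row (1\<^sub>m p :: 'a mat)" "j < dim_col (1\<^sub>m p :: 'a mat)"
    then have i: "i < p" and j: "j < p" by auto
    have "(diag_rank1 f \<mu> w * (D - \<kappa> \<cdot>\<^sub>m (D * outer_prod w w * D))) $$ (i, j)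
      = (\<Sum>k<p. ((if i = k then f i else 0) + \<mu> * (w $ i * w $ k)) * ((if k = j then g k else 0) - \<kappa> * (g k * w $ k * w $ j * g j)))"
    proof (subst mat_mult_entry[of _ p p _ p])
      show "diag_rank1 f \<mu> w \<in> carrier_mat p p" by (simp add: p_def)
      show "D - \<kappa> \<cdot>\<^sub>m (D * outer_prod w w * D) \<in> carrier_mat p p"
        by (intro minus_carrier_mat smult_carrier_mat mult_carrier_mat[of _ p p]) (simp_all add: D' p_def)
    qed (use i j in \<open>simp_all add: inner p_def[symmetric]\<close>)
    \<comment> \<open>The four products of the brackets, with the deltas moved to the index
      \<open>k\<close>: three sums collapse and the fourth is a multiple of
      \<open>\<sigma>\<close>.\<close>
    also have "\<dots> = (\<Sum>k<p. (if k = i then (if i = j then f i * g i else 0) else 0)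
        - (if k = i then \<kappa> * (f i * g i * (w $ i * w $ j * g j)) else 0)
        + (if k = j then \<mu> * (w $ i * w $ j * g j) else 0)
        - \<mu> * \<kappa> * (w $ i * w $ j * g j) * (w $ k * (g k * w $ k)))"
      by (intro sum.cong refl) (auto simp: algebra_simps)
    also have "\<dots> = (if i = j then 1 else 0) + (\<mu> - \<kappa> - \<mu> * \<kappa> * \<sigma>) * (w $ i * w $ j * g j)"
      unfolding sum.distrib sum_subtractf sum_distrib_left[symmetric] \<sigma>[symmetric]
      using i j by (simp add: fg algebra_simps)
    finally show "(diag_rank1 f \<mu> w * (D - \<kappa> \<cdot>\<^sub>m (D * outer_prod w w * D))) $$ (i, j) = 1\<^sub>m p $$ (i, j)"
      using i j \<kappa> by simp
  qed (auto simp: p_def D' mat_diag_def)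
  then show ?thesis by (simp add: \<kappa>_def \<sigma>_def p_def)
qed

section \<open>Block-diagonal matrices and congruences\<close>

lemma block_diag_carrier:
  "A \<in> carrier_mat p p \<Longrightarrow> B \<in> carrier_mat q q \<Longrightarrow> block_diag A B \<in> carrier_mat (p + q) (p + q)"
  by (simp add: block_diag_def)

lemma block_diag_one: "block_diag (1\<^sub>m p) (1\<^sub>m q) = 1\<^sub>m (p + q)"
  by (simp add: block_diag_def)

lemma block_diag_mult:
  fixes A B A' B' :: "'a :: comm_ring_1 mat"
  assumes "A \<in> carrier_mat p p" "A' \<in> carrier_mat p p" "B \<in> carrier_mat q q" "B' \<in> carrier_mat q q"
  shows "block_diag A B * block_diag A' B' = block_diag (A * A') (B * B')"
  unfolding block_diag_def using assms by (subst mult_four_block_mat[of _ p p _ q _ q _ _ p _ q]) auto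

lemma det_block_diag:
  fixes A B :: "'a :: idom mat"
  assumes "A \<in> carrier_mat p p" "B \<in> carrier_mat q q"
  shows "det (block_diag A B) = det A * det B"
  unfolding block_diag_def using assms by (intro det_four_block_mat_lower_left_zero[of _ p _ q]) auto

lemma sum_lessThan_add:
  fixes f :: "nat \<Rightarrow> 'a :: comm_monoid_add"
  shows "(\<Sum>i<p + q. f i) = (\<Sum>i<p. f i) + (\<Sum>j<q. f (p + j))"
  by (induction q) (simp_all add: add_ac)

text \<open>The rank-one parts enter only through the entries of \<open>Q\<close> combined with
  coefficients \<open>u\<close> and \<open>v\<close>; this is where linear dependencies between
  columns can be substituted.\<close>

lemma congruence_block_diag_rank1:
  fixes Q :: "'a :: comm_ring_1 mat"
  assumes Q: "Q \<in> carrier_mat n (dim_vec u + dim_vec v)" and i: "i < n" and j: "j < n"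
  defines "p \<equiv> dim_vec u" and "q \<equiv> dim_vec v"
  shows "(Q * block_diag (diag_rank1 f \<mu> u) (diag_rank1 g \<nu> v) * transpose_mat Q) $$ (i, j)
    = (\<Sum>s<p. Q $$ (i, s) * f s * Q $$ (j, s)) + \<mu> * ((\<Sum>s<p. Q $$ (i, s) * u $ s) * (\<Sum>s<p. Q $$ (j, s) * u $ s))
    + ((\<Sum>s<q. Q $$ (i, p + s) * g s * Q $$ (j, p + s))
      + \<nu> * ((\<Sum>s<q. Q $$ (i, p + s) * v $ s) * (\<Sum>s<q. Q $$ (j, p + s) * v $ s)))"
proof -
  let ?B = "block_diag (diag_rank1 f \<mu> u) (diag_rank1 g \<nu> v)"
  have B: "?B \<in> carrier_mat (p + q) (p + q)"
    unfolding p_def q_def by (intro block_diag_carrier) auto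
  \<comment> \<open>The bilinear form \<open>x^T (diag h + \<eta> z z^T) y\<close>, used once for
    each block.\<close>
  have part: "(\<Sum>t<m. (\<Sum>s<m. x s * ((if s = t then h s else 0) + \<eta> * (z s * z t))) * y t)
     = (\<Sum>s<m. x s * h s * y s) + \<eta> * ((\<Sum>s<m. x s * z s) * (\<Sum>s<m. y s * z s))"
    for m and x y h z :: "nat \<Rightarrow> 'a" and \<eta>
  proof -
    have "(\<Sum>s<m. x s * ((if s = t then h s else 0) + \<eta> * (z s * z t))) = x t * h t + \<eta> * ((\<Sum>s<m. x s * z s) * z t)"
      if "t < m" for t
    proof -
      have "(\<Sum>s<m. x s * ((if s = t then h s else 0) + \<eta> * (z s * z t)))
        = (\<Sum>s<m. (if s = t then x t * h t else 0) + (\<eta> * z t) * (x s * z s))"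
        by (intro sum.cong) (auto simp: algebra_simps)
      then show ?thesis using that by (simp only: sum.distrib sum_distrib_left[symmetric]) (simp add: mult_ac)
    qed
    then have "(\<Sum>t<m. (\<Sum>s<m. x s * ((if s = t then h s else 0) + \<eta> * (z s * z t))) * y t)
      = (\<Sum>t<m. x t * h t * y t + \<eta> * (\<Sum>s<m. x s * z s) * (y t * z t))"
      by (intro sum.cong) (auto simp: algebra_simps)
    then show ?thesis by (simp only: sum.distrib sum_distrib_left[symmetric]) (simp add: mult_ac)
  qed
  have QB: "(Q * ?B) $$ (i, t) = (\<Sum>s<p + q. Q $$ (i, s) * ?B $$ (s, t))" if "t < p + q" for t
    using that Q B i by (intro mat_mult_entry) (auto simp: p_def q_def)
  have "(Q * ?B * transpose_mat Q) $$ (i, j) = (\<Sum>t<p + q. (Q * ?B) $$ (i, t) * Q $$ (j, t))"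
    using Q B i j by (subst mat_mult_entry[of _ n "p + q" _ n]) (auto simp: p_def q_def)
  also have "\<dots> = (\<Sum>t<p + q. (\<Sum>s<p + q. Q $$ (i, s) * ?B $$ (s, t)) * Q $$ (j, t))"
    by (intro sum.cong) (auto simp: QB)
  also have "\<dots> = (\<Sum>t<p. (\<Sum>s<p. Q $$ (i, s) * diag_rank1 f \<mu> u $$ (s, t)) * Q $$ (j, t))
     + (\<Sum>t<q. (\<Sum>s<q. Q $$ (i, p + s) * diag_rank1 g \<nu> v $$ (s, t)) * Q $$ (j, p + t))"
    by (simp add: sum_lessThan_add block_diag_def p_def q_def)
  also have "\<dots> = (\<Sum>t<p. (\<Sum>s<p. Q $$ (i, s) * ((if s = t then f s else 0) + \<mu> * (u $ s * u $ t))) * Q $$ (j, t))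
     + (\<Sum>t<q. (\<Sum>s<q. Q $$ (i, p + s) * ((if s = t then g s else 0) + \<nu> * (v $ s * v $ t))) * Q $$ (j, p + t))"
    by (simp add: p_def q_def)
  finally show ?thesis by (simp only: part)
qed

text \<open>A right inverse suffices: it makes \<open>det A\<close> nonzero, which rules out
  \<open>None\<close>, and the left inverse \<open>C\<close> that is returned equals
  \<open>C * (A * B) = B\<close>.\<close>

lemma mat_inverse_eq_SomeI:
  fixes A :: "'a :: field mat"
  assumes A: "A \<in> carrier_mat n n" and B: "B \<in> carrier_mat n n" and AB: "A * B = 1\<^sub>m n"
  shows "mat_inverse A = Some B"
proof (cases "mat_inverse A")
  case None
  have "det A * det B = 1" using det_mult[OF A B] AB by simp
  then have "det A \<noteq> 0" by auto
  then show ?thesis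
    using det_non_zero_imp_unit[OF A, of "()"] mat_inverse(1)[OF A None, of "()"] by metis
next
  case (Some C)
  then have C: "C * A = 1\<^sub>m n" "C \<in> carrier_mat n n" using mat_inverse(2)[OF A] by auto
  have "C = C * (A * B)" using AB C by simp
  also have "\<dots> = B" using A B C assoc_mult_mat[of C n n A n B n] by simp
  finally show ?thesis using Some by simp
qed

text \<open>The congruence matrix need not be orthogonal: \<open>J\<close> corrects for that, since
  \<open>Q\<inverse> = J Q\<^sup>T\<close>.\<close>

lemma mat_inverse_congruence:
  fixes Q :: "'a :: field mat"
  assumes Q: "Q \<in> carrier_mat n n" and J: "J \<in> carrier_mat n n" and M: "M \<in> carrier_mat n n" and Y: "Y \<in> carrier_mat n n"
    and QJQ: "Q * J * transpose_mat Q = 1\<^sub>m n" and MY: "M * Y = 1\<^sub>m n"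
  shows "mat_inverse (Q * M * transpose_mat Q) = Some (Q * (J * Y * J) * transpose_mat Q)"
proof (rule mat_inverse_eq_SomeI)
  let ?T = "transpose_mat Q"
  note assoc = assoc_mult_mat[of _ n n _ n _ n]
  have T: "?T \<in> carrier_mat n n" using Q by simp
  \<comment> \<open>For square matrices a one-sided inverse is two-sided, so \<open>Q * J\<close>
    and \<open>?T\<close> may be exchanged.\<close>
  have "?T * (Q * J) = 1\<^sub>m n"
    using mat_mult_left_right_inverse[of "Q * J" n ?T] Q J T QJQ by simp
  then have TQJ: "?T * (Q * (J * X)) = X" if "X \<in> carrier_mat n n" for X
  proof -
    have "?T * (Q * J) * X = X" using \<open>?T * (Q * J) = 1\<^sub>m n\<close> that by simp
    then show ?thesis using that Q J T by (simp add: assoc)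
  qed
  have MY': "M * (Y * X) = X" if "X \<in> carrier_mat n n" for X
  proof -
    have "M * Y * X = X" using MY that by simp
    then show ?thesis using that M Y by (simp add: assoc)
  qed
  \<comment> \<open>Nested to the right, the product contains \<open>?T * Q * J\<close>, which
    cancels first, and then \<open>M * Y\<close>.\<close>
  have "(Q * M * ?T) * (Q * (J * Y * J) * ?T) = Q * (M * (?T * (Q * (J * (Y * (J * ?T))))))"
    using Q J M Y T by (simp add: assoc)
  also have "\<dots> = Q * J * ?T" using Q J Y T by (simp add: TQJ MY' assoc)
  finally show "(Q * M * ?T) * (Q * (J * Y * J) * ?T) = 1\<^sub>m n" using QJQ by simp
qed (use assms in auto)

section \<open>Spectral representation of the Hankel matrix\<close>

text \<open>The orthogonal matrix of the discrete sine transform (type I) of order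
  \<open>n + 2\<close>, indexed from 1. The Hankel matrix meets its rows 2 to \<open>n + 1\<close>,
  hence the shift by 2 of 0-based row indices below.\<close>

definition sine_entry :: "nat \<Rightarrow> nat \<Rightarrow> nat \<Rightarrow> complex" where
  "sine_entry n k m = complex_of_real (sqrt (2 / (real n + 3)) * sin (real k * real m * pi / (real n + 3)))"

lemma sine_entry_mult:
  "sine_entry n i m * sine_entry n j m =
    complex_of_real (2 / (real n + 3) * (sin (real i * real m * pi / real (n + 3)) * sin (real j * real m * pi / real (n + 3))))"
proof -
  have "sqrt (2 / (real n + 3)) * sqrt (2 / (real n + 3)) = 2 / (real n + 3)" by simp
  moreover have "(s * x) * (s * y) = (s * s) * (x * y)" for s x y :: real by simp
  ultimately show ?thesis
    unfolding sine_entry_def of_real_mult[symmetric] by (simp only:) simp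
qed

lemma sine_entry_orthonormal:
  assumes "1 \<le> i" "i < n + 3" "1 \<le> j" "j < n + 3"
  shows "(\<Sum>m = 1..<n + 3. sine_entry n i m * sine_entry n j m) = of_bool (i = j)"
proof -
  have "2 / (real n + 3) * (real (n + 3) / 2 * of_bool (i = j)) = of_bool (i = j)" by simp
  then show ?thesis
    unfolding sine_entry_mult of_real_sum[symmetric] sum_distrib_left[symmetric]
      sum_sin_sin[OF assms]
    by simp
qed

text \<open>With the last cosine also written over \<open>n + 3\<close>, the four terms are the
  cases \<open>r = n, ..., n + 3\<close> of the cosine in
  \<open>sum_sin_sin_cos_middle\<close>.\<close>

lemma lam_alt:
  "lam n a b c d m =
    - 2 * a * complex_of_real (cos (real n * real m * pi / real (n + 3)))
    - 2 * b * complex_of_real (cos (real (n + 1) * real m * pi / real (n + 3)))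
    - 2 * c * complex_of_real (cos (real (n + 2) * real m * pi / real (n + 3)))
    - d * complex_of_real (cos (real (n + 3) * real m * pi / real (n + 3)))"
proof -
  have "real (n + 3) * real m * pi / real (n + 3) = real m * pi" by simp
  then show ?thesis by (simp add: lam_def add.commute)
qed

text \<open>The cosine with parameter \<open>r\<close> produces the two antidiagonals at distance
  \<open>n + 3 - r\<close> from the main one. For \<open>r = n + 3\<close> they coincide, which is
  why \<open>d\<close> carries no factor 2 in \<open>lam\<close>.\<close>

lemma hankel_spectral:
  assumes i: "i < n" and j: "j < n"
  shows "hankel n a b c d $$ (i, j)
    = (\<Sum>m = 1..<n + 3. sine_entry n (i + 2) m * lam n a b c d m * sine_entry n (j + 2) m)"
proof -
  let ?N = "n + 3"
  define S where "S r m = sin (real (i + 2) * real m * pi / real ?N) * sin (real (j + 2) * real m * pi / real ?N)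
    * cos (real r * real m * pi / real ?N)" for r m
  define T where "T r = (of_bool (i + 2 + (j + 2) = r) + of_bool (i + 2 + (j + 2) + r = 2 * ?N) :: real)" for r
  have S: "complex_of_real (2 / (real n + 3) * (\<Sum>m = 1..<?N. S r m)) = - complex_of_real (T r) / 2"
    if "?N \<le> r + 3" "r \<le> ?N" for r
  proof -
    have "(\<Sum>m = 1..<?N. S r m) = - real ?N / 4 * T r"
      unfolding S_def T_def using i j that by (intro sum_sin_sin_cos_middle) auto
    then have "2 / (real n + 3) * (\<Sum>m = 1..<?N. S r m) = - T r / 2"
      by (simp add: field_simps)
    then show ?thesis by (simp only: of_real_minus of_real_divide) simp
  qed
  have "(\<Sum>m = 1..<?N. sine_entry n (i + 2) m * lam n a b c d m * sine_entry n (j + 2) m)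
    = (\<Sum>m = 1..<?N. - 2 * a * complex_of_real (2 / (real n + 3) * S n m)
        - 2 * b * complex_of_real (2 / (real n + 3) * S (n + 1) m)
        - 2 * c * complex_of_real (2 / (real n + 3) * S (n + 2) m)
        - d * complex_of_real (2 / (real n + 3) * S (n + 3) m))"
  proof (intro sum.cong refl)
    fix m
    define x where "x = sin (real (i + 2) * real m * pi / real ?N) * sin (real (j + 2) * real m * pi / real ?N)"
    have xS: "S r m = x * cos (real r * real m * pi / real ?N)" for r
      by (simp add: S_def x_def)
    have "sine_entry n (i + 2) m * lam n a b c d m * sine_entry n (j + 2) m
      = complex_of_real (2 / (real n + 3) * x) * lam n a b c d m"
      using sine_entry_mult[of n "i + 2" m "j + 2"] unfolding x_def by (simp only: mult_ac)
    then show "sine_entry n (i + 2) m * lam n a b c d m * sine_entry n (j + 2) m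
      = - 2 * a * complex_of_real (2 / (real n + 3) * S n m)
        - 2 * b * complex_of_real (2 / (real n + 3) * S (n + 1) m)
        - 2 * c * complex_of_real (2 / (real n + 3) * S (n + 2) m)
        - d * complex_of_real (2 / (real n + 3) * S (n + 3) m)"
      unfolding lam_alt xS of_real_mult by (simp only: right_diff_distrib) (simp only: mult_ac minus_mult_left mult_minus_right)
  qed
  also have "\<dots> = a * of_real (T n) + b * of_real (T (n + 1)) + c * of_real (T (n + 2)) + d * (of_real (T (n + 3)) / 2)"
    unfolding sum_subtractf sum_distrib_left[symmetric] of_real_sum[symmetric]
    by (simp only: S[of n] S[of "n + 1"] S[of "n + 2"] S[of "n + 3"]) (simp add: S)
  also have "\<dots> = hankel n a b c d $$ (i, j)"
  proof -
    \<comment> \<open>The main antidiagonal is \<open>i + j + 4 = n + 3\<close>; the seven middle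
      cases are the bands of the matrix.\<close>
    consider "i + j + 4 < n" | "i + j + 4 = n" | "i + j + 4 = n + 1" | "i + j + 4 = n + 2" | "i + j + 4 = n + 3"
      | "i + j + 4 = n + 4" | "i + j + 4 = n + 5" | "i + j + 4 = n + 6" | "n + 6 < i + j + 4"
      by linarith
    then show ?thesis
      using i j by cases (simp_all add: T_def hankel_def mat1_def Let_def)
  qed
  finally show ?thesis by simp
qed

text \<open>The even column expressed through the others has index \<open>2 * (n div 2) + 2\<close>, which is
  \<open>n + 2\<close> for even \<open>n\<close> and \<open>n + 1\<close> for odd \<open>n\<close>. This makes \<open>v\<close> uniform in the parity; \<open>u_odd\<close> already
  is, since \<open>(n + 1) div 2 = n div 2\<close> for even \<open>n\<close>.\<close>

definition v_unified :: "nat \<Rightarrow> complex vec" where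
  "v_unified n = vec1 (n div 2) (\<lambda>j. complex_of_real
     (sin (2 * real j * pi / (real n + 3)) / sin (real (2 * (n div 2) + 2) * pi / (real n + 3))))"

text \<open>The middle rows of the sine matrix, with odd columns 3, 5, ... before even columns 2, 4,
  .... One column of each parity is left out, the first odd and the last even one, so that the
  matrix is square.\<close>

definition sine_columns :: "nat \<Rightarrow> complex mat" where
  "sine_columns n = mat n n (\<lambda>(k, i).
     sine_entry n (k + 2) (if i < (n + 1) div 2 then 2 * i + 3 else 2 * (i - (n + 1) div 2) + 2))"

lemma half_add_half: "(n + 1) div 2 + n div 2 = n" for n :: nat
  by presburger

lemma dim_u_odd [simp]: "dim_vec (u_odd n) = (n + 1) div 2"
  by (simp add: u_odd_def vec1_def)

lemma dim_v_unified [simp]: "dim_vec (v_unified n) = n div 2"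
  by (simp add: v_unified_def vec1_def)

lemma sine_columns_carrier [simp]: "sine_columns n \<in> carrier_mat n n"
  by (simp add: sine_columns_def)

lemma sine_columns_index:
  assumes "k < n"
  shows "s < (n + 1) div 2 \<Longrightarrow> sine_columns n $$ (k, s) = sine_entry n (k + 2) (2 * s + 3)"
    and "s < n div 2 \<Longrightarrow> sine_columns n $$ (k, (n + 1) div 2 + s) = sine_entry n (k + 2) (2 * s + 2)"
  using assms half_add_half[of n] by (auto simp: sine_columns_def)

section \<open>Linear dependence among the sine columns of each parity\<close>

lemma sine_entry_first_row: "sine_entry n 1 m = complex_of_real (sqrt (2 / (real n + 3)) * sin (real m * pi / (real n + 3)))"
  by (simp add: sine_entry_def)

lemma sine_entry_first_row_nonzero:
  assumes "1 \<le> m" "m < n + 3"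
  shows "sine_entry n 1 m \<noteq> 0"
proof -
  have "0 < real m * pi / (real n + 3)" "real m * pi / (real n + 3) < pi"
    using assms by (simp_all add: divide_less_eq mult.commute[of _ pi])
  then have "sin (real m * pi / (real n + 3)) > 0" by (rule sin_gt_zero)
  then show ?thesis unfolding sine_entry_first_row by simp
qed

text \<open>The reflection \<open>sin (m * pi - t)\<close> with \<open>t = m * pi / (n + 3)\<close>
  yields a sign depending only on the parity of the column.\<close>

lemma sine_entry_last_row: "sine_entry n (n + 2) m = (- 1) ^ (m + 1) * sine_entry n 1 m"
proof -
  have "real (n + 2) * real m * pi / (real n + 3) = real m * pi - real m * pi / (real n + 3)"
    by (simp add: field_simps)
  then have "sin (real (n + 2) * real m * pi / (real n + 3)) = (- 1) ^ (m + 1) * sin (real m * pi / (real n + 3))"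
    by (simp only: sin_diff sin_npi cos_npi) simp
  then show ?thesis by (simp add: sine_entry_def)
qed

text \<open>Splits the modes by parity and isolates the two columns that \<open>sine_columns\<close>
  omits.\<close>

lemma sum_modes:
  fixes f :: "nat \<Rightarrow> 'a :: comm_monoid_add"
  shows "(\<Sum>m = 1..<n + 3. f m) =
    (f 1 + (\<Sum>s < (n + 1) div 2. f (2 * s + 3))) + ((\<Sum>s < n div 2. f (2 * s + 2)) + f (2 * (n div 2) + 2))"
proof -
  have "(\<Sum>m = 1..<n + 3. f m) = (\<Sum>m = 1..<(n + 2) + 1. f m)" by (simp add: numeral_3_eq_3)
  also have "\<dots> = (\<Sum>i < Suc ((n + 1) div 2). f (2 * i + 1)) + (\<Sum>j < Suc (n div 2). f (2 * j + 2))"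
    by (subst sum_split_parity) simp
  also have "(\<Sum>i < Suc ((n + 1) div 2). f (2 * i + 1)) = f 1 + (\<Sum>i < (n + 1) div 2. f (2 * i + 3))"
    by (subst sum.lessThan_Suc_shift) (simp add: numeral_3_eq_3)
  finally show ?thesis by simp
qed

text \<open>A middle row of the sine matrix is orthogonal to the first row and to the last one, which
  differ only by alternating signs; hence the odd and the even columns are linearly dependent
  separately.\<close>

lemma sine_columns_dependent:
  assumes k: "k < n"
  shows "(\<Sum>s < (n + 1) div 2. sine_columns n $$ (k, s) * u_odd n $ s) = - sine_entry n (k + 2) 1"
    and "(\<Sum>s < n div 2. sine_columns n $$ (k, (n + 1) div 2 + s) * v_unified n $ s)
      = - sine_entry n (k + 2) (2 * (n div 2) + 2)"
proof -
  define p q x y where "p = (n + 1) div 2" and "q = n div 2"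
    and "x m = sine_entry n (k + 2) m" and "y m = sine_entry n 1 m" for m
  have y: "y 1 \<noteq> 0" "y (2 * q + 2) \<noteq> 0"
    unfolding y_def q_def by (intro sine_entry_first_row_nonzero; simp)+
  \<comment> \<open>The odd and even halves of the inner product of row \<open>k + 2\<close> with
    row 1. Against row \<open>n + 2\<close> the even half changes sign, so both halves
    vanish.\<close>
  define A B where "A = x 1 * y 1 + (\<Sum>s<p. x (2 * s + 3) * y (2 * s + 3))"
    and "B = (\<Sum>s<q. x (2 * s + 2) * y (2 * s + 2)) + x (2 * q + 2) * y (2 * q + 2)"
  have "A + B = (\<Sum>m = 1..<n + 3. x m * y m)"
    unfolding A_def B_def p_def q_def by (rule sum_modes[symmetric])
  also have "\<dots> = 0"
    unfolding x_def y_def using k by (subst sine_entry_orthonormal) auto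
  finally have 1: "A + B = 0" .
  have "A - B = (\<Sum>m = 1..<n + 3. x m * ((- 1) ^ (m + 1) * y m))"
    unfolding A_def B_def p_def q_def by (subst sum_modes) (simp add: sum_negf)
  also have "\<dots> = 0"
    unfolding x_def y_def sine_entry_last_row[symmetric] using k by (subst sine_entry_orthonormal) auto
  finally have 2: "A - B = 0" .
  from 1 2 have A: "A = 0" and B: "B = 0" by (auto simp: add_eq_0_iff)
  have c: "sqrt (2 / (real n + 3)) \<noteq> 0" by simp
  \<comment> \<open>The normalizing square root cancels: \<open>u\<close>, and likewise
    \<open>v\<close>, consists of first-row entries divided by the one in the omitted column of the
    same parity.\<close>
  have u: "u_odd n $ s = y (2 * s + 3) / y 1" if "s < p" for s
  proof -
    have "2 * real (s + 1) + 1 = real (2 * s + 3)" by simp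
    then have *: "u_odd n $ s = complex_of_real (sin (real (2 * s + 3) * pi / (real n + 3)) / sin (real 1 * pi / (real n + 3)))"
      using that unfolding u_odd_def vec1_def p_def by (subst index_vec) (simp_all only: of_nat_1 mult_1)
    then show ?thesis
      unfolding y_def sine_entry_first_row of_real_divide[symmetric] mult_divide_mult_cancel_left[OF c] by (simp only: *)
  qed
  have v: "v_unified n $ s = y (2 * s + 2) / y (2 * q + 2)" if "s < q" for s
  proof -
    have "2 * real (s + 1) = real (2 * s + 2)" by simp
    then have *: "v_unified n $ s = complex_of_real (sin (real (2 * s + 2) * pi / (real n + 3)) / sin (real (2 * q + 2) * pi / (real n + 3)))"
      using that unfolding v_unified_def vec1_def q_def by (subst index_vec) simp_all
    then show ?thesis
      unfolding y_def sine_entry_first_row of_real_divide[symmetric] mult_divide_mult_cancel_left[OF c] by (simp only: *)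
  qed
  have columns: "s < p \<Longrightarrow> sine_columns n $$ (k, s) = x (2 * s + 3)"
    "s < q \<Longrightarrow> sine_columns n $$ (k, p + s) = x (2 * s + 2)" for s
    unfolding p_def q_def x_def by (rule sine_columns_index[OF k]; assumption)+
  have "(\<Sum>s<p. sine_columns n $$ (k, s) * u_odd n $ s) = (\<Sum>s<p. x (2 * s + 3) * y (2 * s + 3)) / y 1"
    unfolding sum_divide_distrib by (intro sum.cong refl) (simp add: u columns)
  also have "\<dots> = - x 1"
    using A y(1) unfolding A_def by (subst divide_eq_eq) (auto simp: eq_neg_iff_add_eq_0 add.commute)
  finally show "(\<Sum>s < (n + 1) div 2. sine_columns n $$ (k, s) * u_odd n $ s) = - sine_entry n (k + 2) 1"
    by (simp add: p_def x_def)
  have "(\<Sum>s<q. sine_columns n $$ (k, p + s) * v_unified n $ s) = (\<Sum>s<q. x (2 * s + 2) * y (2 * s + 2)) / y (2 * q + 2)"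
    unfolding sum_divide_distrib by (intro sum.cong refl) (simp add: v columns)
  also have "\<dots> = - x (2 * q + 2)"
    using B y(2) unfolding B_def by (subst divide_eq_eq) (auto simp: eq_neg_iff_add_eq_0)
  finally show "(\<Sum>s < n div 2. sine_columns n $$ (k, (n + 1) div 2 + s) * v_unified n $ s)
      = - sine_entry n (k + 2) (2 * (n div 2) + 2)"
    by (simp add: p_def q_def x_def)
qed

text \<open>\<open>g m\<close> is the weight of mode \<open>m\<close>; the weights of the two
  omitted columns become the coefficients of the rank-one terms.\<close>

definition mode_blocks :: "nat \<Rightarrow> (nat \<Rightarrow> complex) \<Rightarrow> complex mat" where
  "mode_blocks n g = block_diag (diag_rank1 (\<lambda>s. g (2 * s + 3)) (g 1) (u_odd n))
     (diag_rank1 (\<lambda>s. g (2 * s + 2)) (g (2 * (n div 2) + 2)) (v_unified n))"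

lemma mode_blocks_carrier [simp]: "mode_blocks n g \<in> carrier_mat n n"
  using block_diag_carrier[of "diag_rank1 (\<lambda>s. g (2 * s + 3)) (g 1) (u_odd n)" "(n + 1) div 2"
      "diag_rank1 (\<lambda>s. g (2 * s + 2)) (g (2 * (n div 2) + 2)) (v_unified n)" "n div 2"]
  unfolding mode_blocks_def half_add_half by (metis diag_rank1_carrier dim_u_odd dim_v_unified)

text \<open>By the dependencies each rank-one term restores the mode of an omitted column; the two
  minus signs cancel in the product.\<close>

lemma sine_columns_congruence:
  assumes "i < n" "j < n"
  shows "(sine_columns n * mode_blocks n g * transpose_mat (sine_columns n)) $$ (i, j)
    = (\<Sum>m = 1..<n + 3. sine_entry n (i + 2) m * g m * sine_entry n (j + 2) m)"
proof -
  have Q: "sine_columns n \<in> carrier_mat n (dim_vec (u_odd n) + dim_vec (v_unified n))"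
    by (simp only: dim_u_odd dim_v_unified half_add_half sine_columns_carrier)
  show ?thesis
    unfolding mode_blocks_def congruence_block_diag_rank1[OF Q assms] dim_u_odd dim_v_unified
      sine_columns_dependent[OF assms(1)] sine_columns_dependent[OF assms(2)] sum_modes
    using sine_columns_index[OF assms(1)] sine_columns_index[OF assms(2)]
    by (simp add: algebra_simps)
qed

lemma hankel_eq_congruence:
  "hankel n a b c d = sine_columns n * mode_blocks n (lam n a b c d) * transpose_mat (sine_columns n)"
proof (rule eq_matI)
  fix i j
  assume "i < dim_row (sine_columns n * mode_blocks n (lam n a b c d) * transpose_mat (sine_columns n))"
    "j < dim_col (sine_columns n * mode_blocks n (lam n a b c d) * transpose_mat (sine_columns n))"
  then have "i < n" "j < n" by (auto simp: sine_columns_def)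
  then show "hankel n a b c d $$ (i, j)
    = (sine_columns n * mode_blocks n (lam n a b c d) * transpose_mat (sine_columns n)) $$ (i, j)"
    by (simp only: hankel_spectral sine_columns_congruence)
qed (simp_all add: sine_columns_def hankel_def mat1_def)

text \<open>With all weights 1 the mode sum is the orthonormality of the rows, and the blocks are
  \<open>I + u u^T\<close> and \<open>I + v v^T\<close>, the outer factors of
  \<open>inv_block\<close>.\<close>

lemma one_eq_congruence:
  "sine_columns n * mode_blocks n (\<lambda>_. 1) * transpose_mat (sine_columns n) = 1\<^sub>m n"
proof (rule eq_matI)
  fix i j assume "i < dim_row (1\<^sub>m n :: complex mat)" "j < dim_col (1\<^sub>m n :: complex mat)"
  then have "i < n" "j < n" by auto
  then show "(sine_columns n * mode_blocks n (\<lambda>_. 1) * transpose_mat (sine_columns n)) $$ (i, j) = 1\<^sub>m n $$ (i, j)"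
    using sine_entry_orthonormal[of "i + 2" n "j + 2"] by (simp add: sine_columns_congruence)
qed (simp_all add: sine_columns_def)

section \<open>The inverse\<close>

lemma inv_block_eq:
  "inv_block \<mu> w M = diag_rank1 (\<lambda>_. 1) 1 w
     * (M - (\<mu> / (1 + \<mu> * (w \<bullet> (M *\<^sub>v w)))) \<cdot>\<^sub>m (M * outer_prod w w * M)) * diag_rank1 (\<lambda>_. 1) 1 w"
proof -
  have "1\<^sub>m (dim_vec w) + outer_prod w w = diag_rank1 (\<lambda>_. 1) 1 w"
    by (intro eq_matI) (auto simp: diag_rank1_def)
  then show ?thesis by (simp add: inv_block_def Let_def)
qed

text \<open>The parity-free form of the result: \<open>mat_inverse_congruence\<close> with the
  Sherman-Morrison inverses of both blocks as \<open>Y\<close>.\<close>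

lemma mat_inverse_hankel:
  assumes lam: "\<And>k. 1 \<le> k \<Longrightarrow> k \<le> n + 2 \<Longrightarrow> lam n a b c d k \<noteq> 0"
    and inv: "invertible_mat (hankel n a b c d)"
  defines "lm \<equiv> lam n a b c d"
  shows "mat_inverse (hankel n a b c d) = Some (sine_columns n
    * block_diag (inv_block (lm 1) (u_odd n) (diag1 ((n + 1) div 2) (\<lambda>j. inverse (lm (2 * j + 1)))))
        (inv_block (lm (2 * (n div 2) + 2)) (v_unified n) (diag1 (n div 2) (\<lambda>j. inverse (lm (2 * j)))))
    * transpose_mat (sine_columns n))"
proof -
  define p q where "p = (n + 1) div 2" and "q = n div 2"
  have pq: "p + q = n" by (simp add: p_def q_def half_add_half)
  define A where "A = diag_rank1 (\<lambda>s. lm (2 * s + 3)) (lm 1) (u_odd n)"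
  define B where "B = diag_rank1 (\<lambda>s. lm (2 * s + 2)) (lm (2 * q + 2)) (v_unified n)"
  define D where "D = diag1 p (\<lambda>j. inverse (lm (2 * j + 1)))"
  define E where "E = diag1 q (\<lambda>j. inverse (lm (2 * j)))"
  define Y where "Y \<mu> w M = M - (\<mu> / (1 + \<mu> * (w \<bullet> (M *\<^sub>v w)))) \<cdot>\<^sub>m (M * outer_prod w w * M)"
    for \<mu> and w :: "complex vec" and M
  define J where "J = diag_rank1 (\<lambda>_. 1 :: complex) 1 (u_odd n)"
  define K where "K = diag_rank1 (\<lambda>_. 1 :: complex) 1 (v_unified n)"
  note [simp del] = dim_u_odd dim_v_unified
  have [simp]: "dim_vec (u_odd n) = p" "dim_vec (v_unified n) = q"
    unfolding p_def q_def by (rule dim_u_odd dim_v_unified)+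
  \<comment> \<open>With \<open>j = s + 1\<close>, the indices \<open>2 * j + 1\<close> and
    \<open>2 * j\<close> become \<open>2 * s + 3\<close> and \<open>2 * s + 2\<close>.\<close>
  have D: "D = mat_diag p (\<lambda>s. inverse (lm (2 * s + 3)))" and E: "E = mat_diag q (\<lambda>s. inverse (lm (2 * s + 2)))"
    by (simp_all add: D_def E_def diag1_def numeral_3_eq_3)
  have car: "A \<in> carrier_mat p p" "B \<in> carrier_mat q q" "J \<in> carrier_mat p p" "K \<in> carrier_mat q q"
    using diag_rank1_carrier[of _ _ "u_odd n"] diag_rank1_carrier[of _ _ "v_unified n"]
    unfolding A_def B_def J_def K_def by simp_all
  have carD: "D \<in> carrier_mat p p" "E \<in> carrier_mat q q" by (simp_all add: D E)
  have carY: "Y \<mu> w M \<in> carrier_mat r r" if "M \<in> carrier_mat r r" "dim_vec w = r" for \<mu> w M r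
    using that outer_prod_carrier[of w w] unfolding Y_def
    by (intro minus_carrier_mat smult_carrier_mat mult_carrier_mat[of _ r r]) auto
  have M: "mode_blocks n lm = block_diag A B" and M1: "mode_blocks n (\<lambda>_. 1) = block_diag J K"
    by (simp_all add: mode_blocks_def A_def B_def J_def K_def q_def)
  let ?H = "hankel n a b c d" and ?Q = "sine_columns n"
  have H: "?H \<in> carrier_mat n n" by (simp add: hankel_def mat1_def)
  have "det ?H \<noteq> 0"
  proof -
    obtain X where "?H * X = 1\<^sub>m n" "X * ?H = 1\<^sub>m (dim_row X)"
      using inv H unfolding invertible_mat_def inverts_mat_def by auto
    \<comment> \<open>\<open>invertible_mat\<close> leaves the dimensions of \<open>X\<close> open;
      they follow from the two products.\<close>
    then have "X \<in> carrier_mat n n"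
      using H by (metis carrier_matI carrier_matD index_mult_mat(2,3) index_one_mat(2,3))
    then have "det ?H * det X = 1" using det_mult[OF H, of X] \<open>?H * X = 1\<^sub>m n\<close> by simp
    then show ?thesis by auto
  qed
  \<comment> \<open>Through this factorization nonsingularity of the Hankel matrix passes to each
    block, as Sherman-Morrison requires.\<close>
  moreover have "det ?H = det ?Q * (det A * det B) * det (transpose_mat ?Q)"
  proof -
    have "det ?H = det ?Q * det (mode_blocks n lm) * det (transpose_mat ?Q)"
      unfolding hankel_eq_congruence lm_def[symmetric]
      by (simp only: det_mult[of _ n] mult_carrier_mat[of _ n n] sine_columns_carrier mode_blocks_carrier transpose_carrier_mat)
    then show ?thesis using det_block_diag[OF car(1,2)] by (simp add: M)
  qed
  ultimately have det: "det A \<noteq> 0" "det B \<noteq> 0" by auto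
  have AY: "A * Y (lm 1) (u_odd n) D = 1\<^sub>m p"
    unfolding A_def Y_def using sherman_morrison[of "u_odd n" "\<lambda>s. lm (2 * s + 3)" "lm 1" D] det(1) lam
    by (simp add: A_def D lm_def p_def)
  have BY: "B * Y (lm (2 * q + 2)) (v_unified n) E = 1\<^sub>m q"
    unfolding B_def Y_def using sherman_morrison[of "v_unified n" "\<lambda>s. lm (2 * s + 2)" "lm (2 * q + 2)" E] det(2) lam
    by (simp add: B_def E lm_def q_def)
  let ?Y = "block_diag (Y (lm 1) (u_odd n) D) (Y (lm (2 * q + 2)) (v_unified n) E)"
  have cars: "Y (lm 1) (u_odd n) D \<in> carrier_mat p p" "Y (lm (2 * q + 2)) (v_unified n) E \<in> carrier_mat q q"
    by (intro carY carD; simp)+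
  have "mode_blocks n lm * ?Y = 1\<^sub>m n"
    unfolding M block_diag_mult[OF car(1) cars(1) car(2) cars(2)] AY BY block_diag_one pq ..
  moreover have "?Y \<in> carrier_mat n n" using block_diag_carrier[OF cars] by (simp add: pq)
  ultimately have "mat_inverse ?H = Some (?Q * (block_diag J K * ?Y * block_diag J K) * transpose_mat ?Q)"
    unfolding hankel_eq_congruence lm_def[symmetric] M1[symmetric]
    by (intro mat_inverse_congruence[OF sine_columns_carrier mode_blocks_carrier mode_blocks_carrier _ one_eq_congruence])
  also have "block_diag J K * ?Y * block_diag J K
    = block_diag (inv_block (lm 1) (u_odd n) D) (inv_block (lm (2 * q + 2)) (v_unified n) E)"
    unfolding inv_block_eq J_def[symmetric] K_def[symmetric] Y_def[symmetric]
    by (simp only: block_diag_mult[OF car(3) cars(1) car(4) cars(2)]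
      block_diag_mult[OF mult_carrier_mat[OF car(3) cars(1)] car(3) mult_carrier_mat[OF car(4) cars(2)] car(4)])
  finally show ?thesis by (simp add: D_def E_def p_def q_def)
qed

section \<open>Sine columns as permuted columns of \<open>R\<close>\<close>

lemma permuted_columns_even:
  assumes "even n"
  shows "P_even n * R_even n = transpose_mat (sine_columns n)"
    and "R_even n * transpose_mat (P_even n) = sine_columns n"
proof -
  obtain q where n: "n = 2 * q" using assms by (elim evenE)
  \<comment> \<open>The 0-based position of the 1 in row \<open>i\<close> of \<open>P_even\<close>.
    Adding 2 gives the sine index: \<open>2 * i + 3\<close> in the first half,
    \<open>2 * (i - q) + 2\<close> in the second.\<close>
  define c where "c i = (if i < q then 2 * i + 1 else 2 * (i - q))" for i
  have P: "P_even n $$ (i, s) = (if s = c i then 1 else 0)" if "i < n" "s < n" for i s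
  proof -
    have "s + 1 = 2 * (i + 1) \<or> (s + 1) + n + 1 = 2 * (i + 1) \<longleftrightarrow> s = c i"
      using that unfolding c_def n by auto
    then show ?thesis using that unfolding P_even_def mat1_def by simp
  qed
  have R: "R_even n $$ (s, j) = sine_entry n (s + 2) (j + 2)" if "s < n" "j < n" for s j
    using that by (simp add: R_even_def mat1_def sine_entry_def add_ac)
  have c: "c i < n" if "i < n" for i using that by (auto simp: c_def n)
  have car: "P_even n \<in> carrier_mat n n" "R_even n \<in> carrier_mat n n"
    by (simp_all add: P_even_def R_even_def mat1_def)
  show PR: "P_even n * R_even n = transpose_mat (sine_columns n)"
  proof (rule eq_matI)
    fix i j assume "i < dim_row (transpose_mat (sine_columns n))" "j < dim_col (transpose_mat (sine_columns n))"
    then have ij: "i < n" "j < n" by (simp_all add: sine_columns_def)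
    have "(P_even n * R_even n) $$ (i, j) = (\<Sum>s<n. P_even n $$ (i, s) * R_even n $$ (s, j))"
      using car ij by (rule mat_mult_entry)
    also have "\<dots> = (\<Sum>s<n. if s = c i then R_even n $$ (s, j) else 0)"
      using ij by (intro sum.cong) (auto simp: P)
    also have "\<dots> = sine_entry n (c i + 2) (j + 2)" using c[OF ij(1)] ij by (simp add: R)
    also have "\<dots> = sine_entry n (j + 2) (c i + 2)" by (simp add: sine_entry_def mult_ac)
    also have "\<dots> = sine_columns n $$ (j, i)"
      using ij by (auto simp: sine_columns_def c_def n numeral_3_eq_3)
    finally show "(P_even n * R_even n) $$ (i, j) = transpose_mat (sine_columns n) $$ (i, j)"
      using ij by (simp add: sine_columns_def)
  qed (use car in \<open>auto simp: sine_columns_def\<close>)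
  \<comment> \<open>By this symmetry the second identity is the transpose of the first.\<close>
  have "transpose_mat (R_even n) = R_even n"
    by (intro eq_matI) (auto simp: R_even_def mat1_def mult_ac)
  then have "R_even n * transpose_mat (P_even n) = transpose_mat (P_even n * R_even n)"
    using car by (simp add: transpose_mult)
  then show "R_even n * transpose_mat (P_even n) = sine_columns n" by (simp add: PR)
qed

lemma permuted_columns_odd:
  assumes "odd n"
  shows "R_odd n * P_odd n = sine_columns n"
proof -
  obtain q where n: "n = 2 * q + 1" using assms by (elim oddE)
  \<comment> \<open>The 0-based position of the 1 in column \<open>j\<close> of
    \<open>P_odd\<close>. At \<open>j = q\<close> the pattern \<open>2 * j + 1\<close> would leave
    the range; the last column of \<open>R_odd\<close> is taken instead, which holds sine index
    \<open>n + 2\<close> in place of the omitted index \<open>n + 1\<close>.\<close>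
  define c where "c j = (if j < q then 2 * j + 1 else if j = q then 2 * q else 2 * (j - (q + 1)))" for j
  have P: "P_odd n $$ (s, j) = (if s = c j then 1 else 0)" if "j < n" "s < n" for j s
  proof -
    have "s + 1 = 2 * (j + 1) \<or> (s + 1) + n + 2 = 2 * (j + 1) \<or> s + 1 = n \<and> j + 1 = (n + 1) div 2 \<longleftrightarrow> s = c j"
      using that unfolding c_def n by auto
    then show ?thesis using that unfolding P_odd_def mat1_def by simp
  qed
  have R: "R_odd n $$ (i, s) = sine_entry n (i + 2) (if s + 1 < n then s + 2 else n + 2)" if "i < n" "s < n" for i s
    using that by (auto simp: R_odd_def mat1_def sine_entry_def add_ac)
  have c: "c j < n" if "j < n" for j using that by (auto simp: c_def n)
  have car: "P_odd n \<in> carrier_mat n n" "R_odd n \<in> carrier_mat n n"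
    by (simp_all add: P_odd_def R_odd_def mat1_def)
  show ?thesis
  proof (rule eq_matI)
    fix i j assume "i < dim_row (sine_columns n)" "j < dim_col (sine_columns n)"
    then have ij: "i < n" "j < n" by (simp_all add: sine_columns_def)
    have "(R_odd n * P_odd n) $$ (i, j) = (\<Sum>s<n. R_odd n $$ (i, s) * P_odd n $$ (s, j))"
      using car(2,1) ij by (rule mat_mult_entry)
    also have "\<dots> = (\<Sum>s<n. if s = c j then R_odd n $$ (i, s) else 0)"
      using ij by (intro sum.cong) (auto simp: P)
    also have "\<dots> = sine_entry n (i + 2) (if c j + 1 < n then c j + 2 else n + 2)"
      using c[OF ij(2)] ij by (simp add: R)
    also have "(if c j + 1 < n then c j + 2 else n + 2)
      = (if j < (n + 1) div 2 then 2 * j + 3 else 2 * (j - (n + 1) div 2) + 2)"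
      using ij by (auto simp: c_def n)
    finally show "(R_odd n * P_odd n) $$ (i, j) = sine_columns n $$ (i, j)"
      using ij by (simp add: sine_columns_def)
  qed (use car in \<open>auto simp: sine_columns_def\<close>)
qed

theorem theorem3:
  fixes n :: nat and a b c d :: complex
  assumes "n \<ge> 1"
    and "\<And>k. 1 \<le> k \<Longrightarrow> k \<le> n + 2 \<Longrightarrow> lam n a b c d k \<noteq> 0"
    and "invertible_mat (hankel n a b c d)"
  shows
    "(even n \<longrightarrow>
       (let lm = lam n a b c d;
            D = diag1 (n div 2) (\<lambda>j. inverse (lm (2 * j + 1)));
            E = diag1 (n div 2) (\<lambda>j. inverse (lm (2 * j)));
            U = inv_block (lm 1) (u_even n) D;
            V = inv_block (lm (n + 2)) (v_even n) E
        in mat_inverse (hankel n a b c d) =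
             Some (R_even n * transpose_mat (P_even n) * block_diag U V * P_even n * R_even n)))
     \<and>
     (odd n \<longrightarrow>
       (let lm = lam n a b c d;
            D = diag1 ((n + 1) div 2) (\<lambda>j. inverse (lm (2 * j + 1)));
            E = diag1 ((n - 1) div 2) (\<lambda>j. inverse (lm (2 * j)));
            U = inv_block (lm 1) (u_odd n) D;
            V = inv_block (lm (n + 1)) (v_odd n) E
        in mat_inverse (hankel n a b c d) =
             Some (R_odd n * P_odd n * block_diag U V * transpose_mat (P_odd n) * transpose_mat (R_odd n))))"
proof -
  define lm where "lm = lam n a b c d"
  define W where "W = block_diag (inv_block (lm 1) (u_odd n) (diag1 ((n + 1) div 2) (\<lambda>j. inverse (lm (2 * j + 1)))))
        (inv_block (lm (2 * (n div 2) + 2)) (v_unified n) (diag1 (n div 2) (\<lambda>j. inverse (lm (2 * j)))))"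
  have inverse: "mat_inverse (hankel n a b c d) = Some (sine_columns n * W * transpose_mat (sine_columns n))"
    unfolding W_def lm_def by (rule mat_inverse_hankel[OF assms(2,3)])
  have dims: "dim_row (inv_block \<mu> w M) = dim_vec w" "dim_col (inv_block \<mu> w M) = dim_vec w" for \<mu> w M
    by (simp_all add: inv_block_eq)
  have W: "W \<in> carrier_mat n n"
    unfolding W_def using half_add_half[of n] by (intro carrier_matI) (simp_all add: block_diag_def dims)
  have even_case: "mat_inverse (hankel n a b c d) =
      Some (R_even n * transpose_mat (P_even n) * block_diag (inv_block (lm 1) (u_even n) (diag1 (n div 2) (\<lambda>j. inverse (lm (2 * j + 1)))))
        (inv_block (lm (n + 2)) (v_even n) (diag1 (n div 2) (\<lambda>j. inverse (lm (2 * j))))) * P_even n * R_even n)"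
    if "even n"
  proof -
    have half: "(n + 1) div 2 = n div 2" "2 * (n div 2) = n" using that by auto
    have u: "u_even n = u_odd n" by (simp only: u_even_def u_odd_def half)
    \<comment> \<open>The omitted even column is \<open>n + 2\<close> here, and reflection at
      \<open>pi\<close> turns the sine in its denominator into
      \<open>sin (pi / (n + 3))\<close>.\<close>
    have v: "v_even n = v_unified n"
    proof -
      have "real (n + 2) * pi / (real n + 3) = pi - pi / (real n + 3)" by (simp add: field_simps)
      then have "sin (real (n + 2) * pi / (real n + 3)) = sin (pi / (real n + 3))" by (simp only: sin_pi_minus)
      then show ?thesis by (simp only: v_even_def v_unified_def half)
    qed
    have car: "P_even n \<in> carrier_mat n n" "R_even n \<in> carrier_mat n n"
      by (simp_all add: P_even_def R_even_def mat1_def)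
    have "sine_columns n * W * P_even n * R_even n = sine_columns n * W * (P_even n * R_even n)"
      using car W by (intro assoc_mult_mat[of _ n n _ n _ n] mult_carrier_mat[of _ n n]) auto
    then show ?thesis
      unfolding inverse permuted_columns_even(2)[OF that] u v
      by (simp only: permuted_columns_even(1)[OF that] W_def half)
  qed
  have odd_case: "mat_inverse (hankel n a b c d) =
      Some (R_odd n * P_odd n * block_diag (inv_block (lm 1) (u_odd n) (diag1 ((n + 1) div 2) (\<lambda>j. inverse (lm (2 * j + 1)))))
        (inv_block (lm (n + 1)) (v_odd n) (diag1 ((n - 1) div 2) (\<lambda>j. inverse (lm (2 * j))))) * transpose_mat (P_odd n) * transpose_mat (R_odd n))"
    if "odd n"
  proof -
    \<comment> \<open>For odd \<open>n\<close> the omitted even column is \<open>n + 1\<close>,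
      which gives the denominator in \<open>v_odd\<close> and the parameter
      \<open>lm (n + 1)\<close>.\<close>
    have half: "(n - 1) div 2 = n div 2" "2 * (n div 2) + 2 = n + 1" using that by presburger+
    have v: "v_odd n = v_unified n" unfolding v_odd_def v_unified_def half by (simp add: add.commute)
    have car: "P_odd n \<in> carrier_mat n n" "R_odd n \<in> carrier_mat n n"
      by (simp_all add: P_odd_def R_odd_def mat1_def)
    have "sine_columns n * W * transpose_mat (P_odd n) * transpose_mat (R_odd n)
      = sine_columns n * W * (transpose_mat (P_odd n) * transpose_mat (R_odd n))"
      using car W by (intro assoc_mult_mat[of _ n n _ n _ n] mult_carrier_mat[of _ n n]) auto
    also have "transpose_mat (P_odd n) * transpose_mat (R_odd n) = transpose_mat (sine_columns n)"
      using transpose_mult[OF car(2,1)] permuted_columns_odd[OF that] by simp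
    finally show ?thesis
      unfolding inverse permuted_columns_odd[OF that] v
      by (simp only: W_def half)
  qed
  show ?thesis
    using even_case odd_case unfolding Let_def lm_def by blast
qed

end
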